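(* Let $a_1,a_2,b_1,b_2$ be real numbers. For $h\neq0$ put $r_1=a_1/h$, $r_2=a_2/h$, $\rho_1=a_1/h+b_1$, $\rho_2=a_2/h+b_2$, and let $L_h$ be the operator obtained from the Dunkl shift operator by the change of variable $x=y/h$: $$L_hf(y)=\frac{(y-\rho_1h)(y-\rho_2h)}{2hy}(f(y)-f(-y))+\frac{(y-r_1h+\frac h2)(y-r_2h+\frac h2)}{h(2y+h)}(f(-y-h)-f(y)).$$ Then for every polynomial $f$ and every real $y\ne0$, $$\lim_{h\to0}L_hf(y)=L_0f(y),\qquad L_0=\frac{(y-a_1)(y-a_2)}{2y}\,\partial_yR-\frac{(2b_1+2b_2+1)y^2-2(a_1b_2+a_2b_1)y-a_1a_2}{4y^2}\,(I-R).$$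
   Context: $Rf(y)=f(-y)$, and $\partial_yRf(y)=\frac{d}{dy}\big(f(-y)\big)=-f'(-y)$. The Dunkl shift operator in the variable $x$ is $Lf(x)=\frac{(x-\rho_1)(x-\rho_2)}{2x}(f(x)-f(-x))+\frac{(x-r_1+1/2)(x-r_2+1/2)}{2x+1}(f(-x-1)-f(x))$. *)

theory Defs
  imports "HOL-Analysis.Analysis" "HOL-Computational_Algebra.Polynomial"
begin

definition reflect :: "(real \<Rightarrow> real) \<Rightarrow> real \<Rightarrow> real" where
  "reflect f = (\<lambda>y. f (- y))"

definition dunkl_shift ::
  "real \<Rightarrow> real \<Rightarrow> real \<Rightarrow> real \<Rightarrow> (real \<Rightarrow> real) \<Rightarrow> real \<Rightarrow> real" where
  "dunkl_shift \<rho>\<^sub>1 \<rho>\<^sub>2 r\<^sub>1 r\<^sub>2 f x =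
     (x - \<rho>\<^sub>1) * (x - \<rho>\<^sub>2) / (2 * x) * (f x - f (- x)) +
     (x - r\<^sub>1 + 1/2) * (x - r\<^sub>2 + 1/2) / (2 * x + 1) * (f (- x - 1) - f x)"

definition scaled_dunkl_shift ::
  "real \<Rightarrow> real \<Rightarrow> real \<Rightarrow> real \<Rightarrow> real \<Rightarrow> (real \<Rightarrow> real) \<Rightarrow> real \<Rightarrow> real" where
  "scaled_dunkl_shift h \<rho>\<^sub>1 \<rho>\<^sub>2 r\<^sub>1 r\<^sub>2 f y =
     (y - \<rho>\<^sub>1 * h) * (y - \<rho>\<^sub>2 * h) / (2 * h * y) * (f y - f (- y)) +
     (y - r\<^sub>1 * h + h/2) * (y - r\<^sub>2 * h + h/2) / (h * (2 * y + h)) * (f (- y - h) - f y)"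

text \<open>The scaled operator is the Dunkl shift operator conjugated by the dilation \<open>x = y / h\<close>:
  a function \<open>f\<close> of \<open>y\<close> is the function \<open>\<lambda>x. f (h * x)\<close> of \<open>x\<close>.
  At \<open>y = 0\<close> and \<open>2 * y + h = 0\<close> both sides only follow the convention \<open>x / 0 = 0\<close>.\<close>

lemma scaled_dunkl_shift_change_of_variable:
  assumes "h \<noteq> 0"
  shows "scaled_dunkl_shift h \<rho>\<^sub>1 \<rho>\<^sub>2 r\<^sub>1 r\<^sub>2 f y =
    dunkl_shift \<rho>\<^sub>1 \<rho>\<^sub>2 r\<^sub>1 r\<^sub>2 (\<lambda>x. f (h * x)) (y / h)"
proof -
  have 1: "(y / h - \<rho>\<^sub>1) * (y / h - \<rho>\<^sub>2) / (2 * (y / h)) =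
      (y - \<rho>\<^sub>1 * h) * (y - \<rho>\<^sub>2 * h) / (2 * h * y)"
    using assms by (cases "y = 0") (simp_all add: field_simps)
  have e: "2 * (y / h) + 1 = (2 * y + h) / h"
      "y / h - r\<^sub>1 + 1/2 = (y - r\<^sub>1 * h + h/2) / h"
      "y / h - r\<^sub>2 + 1/2 = (y - r\<^sub>2 * h + h/2) / h"
    using assms by (simp_all add: field_simps)
  have 2: "(y / h - r\<^sub>1 + 1/2) * (y / h - r\<^sub>2 + 1/2) / (2 * (y / h) + 1) =
      (y - r\<^sub>1 * h + h/2) * (y - r\<^sub>2 * h + h/2) / (h * (2 * y + h))"
    unfolding e using assms by simp
  have 3: "h * (y / h) = y" "h * - (y / h) = - y" "h * (- (y / h) - 1) = - y - h"
    using assms by (simp_all add: algebra_simps)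
  show ?thesis
    unfolding scaled_dunkl_shift_def dunkl_shift_def 1 2 3 ..
qed

definition limit_operator ::
  "real \<Rightarrow> real \<Rightarrow> real \<Rightarrow> real \<Rightarrow> (real \<Rightarrow> real) \<Rightarrow> real \<Rightarrow> real" where
  "limit_operator a\<^sub>1 a\<^sub>2 b\<^sub>1 b\<^sub>2 f y =
     (y - a\<^sub>1) * (y - a\<^sub>2) / (2 * y) * deriv (reflect f) y -
     ((2 * b\<^sub>1 + 2 * b\<^sub>2 + 1) * y\<^sup>2 - 2 * (a\<^sub>1 * b\<^sub>2 + a\<^sub>2 * b\<^sub>1) * y - a\<^sub>1 * a\<^sub>2) / (4 * y\<^sup>2) *
       (f y - reflect f y)"

end

theory Submission
  imports Defs
begin

text \<open>With \<open>r\<^sub>i = a\<^sub>i / h\<close> and \<open>\<rho>\<^sub>i = a\<^sub>i / h + b\<^sub>i\<close> both coefficients of the scaled operator have at most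
  a simple pole at \<open>h = 0\<close>, with the same residue \<open>(y - a\<^sub>1) * (y - a\<^sub>2) / (2 * y)\<close>. Splitting
  \<open>f (- y - h) - f y = (f (- y - h) - f (- y)) - (f y - f (- y))\<close> tames both poles: the first difference,
  divided by \<open>h\<close>, is a difference quotient of \<open>reflect f\<close> at \<open>y\<close> and gives the derivative term, while
  the second one has the same factor \<open>f y - f (- y)\<close> as the first summand of the operator, so that
  the two poles cancel and the next order in \<open>h\<close> gives the coefficient of \<open>I - R\<close>. This is
  \<open>scaled_dunkl_shift_split\<close>; after it, every factor is continuous in \<open>h\<close> at \<open>0\<close> apart from the
  difference quotient.\<close>

text \<open>The purpose of this form is that only the difference quotient still has \<open>h\<close> in a denominator
  that vanishes at \<open>h = 0\<close>. The last fraction is the difference of the two coefficients after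
  cancelling \<open>h\<close>; at \<open>h = 0\<close> it is, including the sign, the coefficient of \<open>I - R\<close> in the limit.\<close>

lemma scaled_dunkl_shift_split:
  fixes a\<^sub>1 a\<^sub>2 b\<^sub>1 b\<^sub>2 y h :: real and f :: "real \<Rightarrow> real"
  defines "u \<equiv> y - a\<^sub>1" and "v \<equiv> y - a\<^sub>2"
  assumes "y \<noteq> 0" "h \<noteq> 0" "2 * y + h \<noteq> 0"
  shows "scaled_dunkl_shift h (a\<^sub>1 / h + b\<^sub>1) (a\<^sub>2 / h + b\<^sub>2) (a\<^sub>1 / h) (a\<^sub>2 / h) f y =
    (u + h/2) * (v + h/2) / (2 * y + h) * ((reflect f (y + h) - reflect f y) / h) +
    (u * v - 2 * y * (b\<^sub>1 * v + b\<^sub>2 * u) - y * (u + v)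
       + h * (2 * y * b\<^sub>1 * b\<^sub>2 - (b\<^sub>1 * v + b\<^sub>2 * u) - y / 2 + h * b\<^sub>1 * b\<^sub>2)) /
      (2 * y * (2 * y + h)) * (f y - reflect f y)"
    (is "_ = ?Q / _ * _ + ?N / _ * _")
proof -
  have shift: "y - (a\<^sub>1 / h + b\<^sub>1) * h = u - b\<^sub>1 * h" "y - (a\<^sub>2 / h + b\<^sub>2) * h = v - b\<^sub>2 * h"
      "y - a\<^sub>1 / h * h + h/2 = u + h/2" "y - a\<^sub>2 / h * h + h/2 = v + h/2"
    using \<open>h \<noteq> 0\<close> by (simp_all add: u_def v_def field_simps)
  have pole_cancels: "(u - b\<^sub>1 * h) * (v - b\<^sub>2 * h) * (2 * y + h) = 2 * y * ?Q + h * ?N"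
    by (simp add: field_simps)
  have first_coefficient: "(u - b\<^sub>1 * h) * (v - b\<^sub>2 * h) / (2 * h * y) =
      ?Q / (h * (2 * y + h)) + ?N / (2 * y * (2 * y + h))"
  proof -
    have "(u - b\<^sub>1 * h) * (v - b\<^sub>2 * h) / (2 * h * y) =
        (u - b\<^sub>1 * h) * (v - b\<^sub>2 * h) * (2 * y + h) / (2 * h * y * (2 * y + h))"
      using assms by simp
    also have "\<dots> = 2 * y * ?Q / (2 * h * y * (2 * y + h)) + h * ?N / (2 * h * y * (2 * y + h))"
      unfolding pole_cancels by (rule add_divide_distrib)
    also have "\<dots> = ?Q / (h * (2 * y + h)) + ?N / (2 * y * (2 * y + h))"
      using assms(3-5) by (simp add: mult.assoc mult.left_commute[of _ h])
    finally show ?thesis .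
  qed
  have recombine: "(q / (h * w) + n) * (f y - s) + q / (h * w) * (t - f y)
      = q / w * ((t - s) / h) + n * (f y - s)" for q w n s t :: real
    by (simp add: algebra_simps diff_divide_distrib)
  have "reflect f (y + h) = f (- y - h)" "reflect f y = f (- y)"
    by (simp_all add: reflect_def)
  then show ?thesis
    unfolding scaled_dunkl_shift_def shift first_coefficient by (simp only: recombine)
qed

lemma tendsto_scaled_dunkl_shift:
  fixes a\<^sub>1 a\<^sub>2 b\<^sub>1 b\<^sub>2 y :: real and f :: "real \<Rightarrow> real"
  assumes "y \<noteq> 0" and "f differentiable (at (- y))"
  shows "((\<lambda>h. scaled_dunkl_shift h (a\<^sub>1 / h + b\<^sub>1) (a\<^sub>2 / h + b\<^sub>2) (a\<^sub>1 / h) (a\<^sub>2 / h) f y)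
    \<longlongrightarrow> limit_operator a\<^sub>1 a\<^sub>2 b\<^sub>1 b\<^sub>2 f y) (at 0)"
proof -
  define u v where "u = y - a\<^sub>1" and "v = y - a\<^sub>2"
  define Q where "Q h = (u + h/2) * (v + h/2) / (2 * y + h)" for h
  define N where "N h = (u * v - 2 * y * (b\<^sub>1 * v + b\<^sub>2 * u) - y * (u + v)
       + h * (2 * y * b\<^sub>1 * b\<^sub>2 - (b\<^sub>1 * v + b\<^sub>2 * u) - y / 2 + h * b\<^sub>1 * b\<^sub>2)) /
      (2 * y * (2 * y + h))" for h
  have "f \<circ> uminus differentiable (at y)"
    using assms(2) by (intro differentiable_chain_at) (auto intro: derivative_intros)
  then have "(reflect f has_real_derivative deriv (reflect f) y) (at y)"
    by (simp add: DERIV_deriv_iff_real_differentiable reflect_def comp_def)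
  then have quotient:
    "((\<lambda>h. (reflect f (y + h) - reflect f y) / h) \<longlongrightarrow> deriv (reflect f) y) (at 0)"
    by (simp add: DERIV_def)
  have "(Q \<longlongrightarrow> Q 0) (at 0)"
    unfolding Q_def using assms(1) by (intro tendsto_intros) auto
  moreover have "(N \<longlongrightarrow> N 0) (at 0)"
    unfolding N_def using assms(1) by (intro tendsto_intros) auto
  ultimately have "((\<lambda>h. Q h * ((reflect f (y + h) - reflect f y) / h) + N h * (f y - reflect f y))
      \<longlongrightarrow> Q 0 * deriv (reflect f) y + N 0 * (f y - reflect f y)) (at 0)"
    by (intro tendsto_intros quotient)
  moreover have "Q 0 * deriv (reflect f) y + N 0 * (f y - reflect f y)
      = limit_operator a\<^sub>1 a\<^sub>2 b\<^sub>1 b\<^sub>2 f y"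
  proof -
    have "N 0 = - (((2 * b\<^sub>1 + 2 * b\<^sub>2 + 1) * y\<^sup>2 - 2 * (a\<^sub>1 * b\<^sub>2 + a\<^sub>2 * b\<^sub>1) * y - a\<^sub>1 * a\<^sub>2) / (4 * y\<^sup>2))"
      unfolding N_def u_def v_def minus_divide_left
      by (rule arg_cong2[where f = "(/)"]) (simp_all add: algebra_simps power2_eq_square)
    then show ?thesis
      by (simp add: limit_operator_def Q_def u_def v_def)
  qed
  moreover have "\<forall>\<^sub>F h in at 0.
      Q h * ((reflect f (y + h) - reflect f y) / h) + N h * (f y - reflect f y)
      = scaled_dunkl_shift h (a\<^sub>1 / h + b\<^sub>1) (a\<^sub>2 / h + b\<^sub>2) (a\<^sub>1 / h) (a\<^sub>2 / h) f y"
  proof -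
    have "\<forall>\<^sub>F h in at 0. h \<noteq> - 2 * y"
      using assms(1) by (intro eventually_neq_at_within)
    moreover have "\<forall>\<^sub>F h in at 0. h \<noteq> (0 :: real)"
      by (rule eventually_neq_at_within)
    ultimately show ?thesis
    proof eventually_elim
      case (elim h)
      then have "2 * y + h \<noteq> 0" by auto
      with elim assms(1) show ?case
        unfolding Q_def N_def u_def v_def by (intro scaled_dunkl_shift_split[symmetric])
    qed
  qed
  ultimately show ?thesis
    by (auto intro: Lim_transform_eventually)
qed

theorem mainTheorem18:
  fixes a\<^sub>1 a\<^sub>2 b\<^sub>1 b\<^sub>2 y :: real and f :: "real poly"
  assumes "y \<noteq> 0"
  shows "((\<lambda>h. scaled_dunkl_shift h (a\<^sub>1 / h + b\<^sub>1) (a\<^sub>2 / h + b\<^sub>2) (a\<^sub>1 / h) (a\<^sub>2 / h) (poly f) y)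
    \<longlongrightarrow> limit_operator a\<^sub>1 a\<^sub>2 b\<^sub>1 b\<^sub>2 (poly f) y) (at 0)"
  using assms by (intro tendsto_scaled_dunkl_shift poly_differentiable)

end
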